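(* Let $n$ be a positive integer, $m$ an integer with $0 \le m \le n$, $\tau > 0$, $a_0, \dotsc, a_{n-1}, \alpha_0, \dotsc, \alpha_m \in \mathbb R$, and let $\Delta: \mathbb C \to \mathbb C$ be the quasipolynomial \[ \Delta(s) = s^n + \sum_{k=0}^{n-1} a_k s^k + e^{-s\tau} \sum_{k=0}^{m} \alpha_k s^k . \] Let $s_0 \in \mathbb R$. Then $s_0$ is a root of multiplicity $m+n+1$ of $\Delta$ if and only if \[ a_k = \binom{n}{k} (-s_0)^{n-k} + (-1)^{n-k}\, n! \sum_{j=k}^{n-1} \frac{\binom{j}{k}\binom{m+n-j}{m} s_0^{j-k}}{j!\,\tau^{n-j}} \quad \text{for every integer } k \text{ with } 0 \le k \le n-1, \] and \[ \alpha_k = (-1)^{n-1} e^{s_0 \tau} \sum_{j=k}^{m} \frac{(-1)^{j-k} (m+n-j)!\, s_0^{j-k}}{k!\,(j-k)!\,(m-j)!\,\tau^{n-j}} \quad \text{for every integer } k \text{ with } 0 \le k \le m . \]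
   Context: Multiplicity of a root is its order as a zero of the entire function $\Delta$. The convention $s_0^0 = 1$ is used, including when $s_0 = 0$. *)

theory Defs
  imports "HOL-Complex_Analysis.Complex_Analysis"
begin

text \<open>
  Only the values \<open>a 0, \<dots>, a (n - 1)\<close> and \<open>\<alpha> 0, \<dots>, \<alpha> m\<close> of the coefficient sequences matter.
\<close>

definition quasipoly ::
    "nat \<Rightarrow> nat \<Rightarrow> real \<Rightarrow> (nat \<Rightarrow> real) \<Rightarrow> (nat \<Rightarrow> real) \<Rightarrow> complex \<Rightarrow> complex" where
  "quasipoly n m \<tau> a \<alpha> s =
     s ^ n + (\<Sum>k<n. of_real (a k) * s ^ k)
     + exp (- s * of_real \<tau>) * (\<Sum>k\<le>m. of_real (\<alpha> k) * s ^ k)"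

text \<open>
  The library's \<^const>\<open>zorder\<close> is unspecified for a function vanishing identically near the point.
  This case does not arise for \<^const>\<open>quasipoly\<close> with \<open>\<tau> > 0\<close>: it is entire and, since its
  part without exponential is a monic polynomial, it is not identically zero.
\<close>

definition root_of_multiplicity :: "(complex \<Rightarrow> complex) \<Rightarrow> complex \<Rightarrow> nat \<Rightarrow> bool" where
  "root_of_multiplicity f z N \<longleftrightarrow> f z = 0 \<and> zorder f z = int N"

end

theory Submission
  imports Defs
begin

text \<open>
  Expanding \<open>\<Delta>\<close> at \<open>s\<^sub>0\<close> in the local variable \<open>u = s - s\<^sub>0\<close> gives \<open>P(u) + e\<^sup>t\<^sup>u S(u)\<close> with \<open>t = - \<tau>\<close>,
  where \<open>P\<close> is monic of degree \<open>n\<close> and \<open>S\<close> has degree at most \<open>m\<close>. Both are Taylor shifts of the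
  two polynomials in \<open>\<Delta>\<close>, the second one scaled by \<open>e\<close> to the power \<open>- s\<^sub>0 \<tau>\<close>. The multiplicity of
  \<open>s\<^sub>0\<close> is the order of this power series, so the whole question is one of Hermite-Pade
  approximation of the exponential function, and it can be settled with formal power series.

  Two facts decide it. The first is a bound of Polya-Szego type (\<open>exp_poly_fps_eq_0D\<close>): a nonzero
  \<open>P + e\<^sup>t\<^sup>u S\<close> cannot vanish at \<open>0\<close> to an order equal to the total number of available
  coefficients. It follows by differentiating until \<open>P\<close> is gone. Used with \<open>n + 1\<close> coefficients
  for \<open>P\<close>, it shows that the order is at most \<open>m + n + 1\<close>; used with \<open>n\<close> coefficients, for the
  difference of two solutions with equal leading coefficients, it shows that at most one pair
  \<open>(P, S)\<close> attains this order. The second fact (\<open>exp_poly_fps_pade_nth\<close>) is that the explicit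
  Pade pair attains it, by an alternating binomial identity.

  The formulas of the theorem are then the coefficients of the Pade pair shifted back from
  \<open>u\<close> to \<open>s\<close>, with the scaling of the second polynomial undone.
\<close>

section \<open>Polynomials and Taylor shifts\<close>

(* Leaves $ to mean the coefficient of a formal power series. *)
unbundle no vec_syntax

lemma coeff_sum_monom_atMost:
  "coeff (\<Sum>i\<le>d. monom (f i) i) k = (if k \<le> d then f k else 0)"
  by (auto simp: coeff_sum_monom) (simp add: coeff_sum)

lemma poly_eq_iff_coeff_le:
  assumes "degree p \<le> d" "degree q \<le> d"
  shows "p = q \<longleftrightarrow> (\<forall>k\<le>d. coeff p k = coeff q k)"
proof
  assume *: "\<forall>k\<le>d. coeff p k = coeff q k"
  show "p = q"
  proof (rule poly_eqI)
    fix k show "coeff p k = coeff q k"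
      using * assms by (cases "k \<le> d") (simp_all add: coeff_eq_0)
  qed
qed simp

lemma degree_sum_monom_atMost: "degree (\<Sum>i\<le>d. monom (f i) i) \<le> d"
  by (rule degree_le) (simp add: coeff_sum_monom_atMost)

lemma coeff_pcompose_shift:
  fixes p :: "'a::comm_ring_1 poly"
  assumes "degree p \<le> d"
  shows "coeff (pcompose p [:c, 1:]) k = (\<Sum>j = k..d. coeff p j * of_nat (j choose k) * c ^ (j - k))"
proof -
  have "pcompose p [:c, 1:] = pcompose (\<Sum>j\<le>d. monom (coeff p j) j) [:c, 1:]"
    by (simp add: poly_as_sum_of_monoms' assms)
  also have "\<dots> = (\<Sum>j\<le>d. smult (coeff p j) ([:c, 1:] ^ j))"
    unfolding pcompose_sum by (simp add: pcompose_altdef map_poly_monom poly_monom)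
  also have "coeff \<dots> k = (\<Sum>j\<le>d. coeff p j * coeff ([:c, 1:] ^ j) k)"
    by (simp add: coeff_sum)
  also have "\<dots> = (\<Sum>j = k..d. coeff p j * of_nat (j choose k) * c ^ (j - k))"
  proof (rule sum.mono_neutral_cong_right)
    show "\<forall>j\<in>{..d} - {k..d}. coeff p j * coeff ([:c, 1:] ^ j) k = 0"
    proof safe
      fix j assume "j \<le> d" "j \<notin> {k..d}"
      then have "degree ([:c, 1:] ^ j) < k"
        using degree_power_le[of "[:c, 1:]" j] by auto
      then show "coeff p j * coeff ([:c, 1:] ^ j) k = 0"
        by (simp add: coeff_eq_0)
    qed
  qed (auto simp: coeff_linear_poly_power mult.assoc)
  finally show ?thesis .
qed

lemma degree_pcompose_shift_le:
  fixes p :: "'a::comm_ring_1 poly"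
  assumes "degree p \<le> d"
  shows "degree (pcompose p [:c, 1:]) \<le> d"
  using degree_pcompose_le[of p "[:c, 1:]"] assms by simp

lemma pcompose_shift_eq_iff:
  fixes p q :: "'a::comm_ring_1 poly"
  shows "pcompose p [:c, 1:] = q \<longleftrightarrow> p = pcompose q [:- c, 1:]"
proof -
  have "pcompose [:c, 1:] [:- c, 1:] = [:0, 1:]" "pcompose [:- c, 1:] [:c, 1:] = [:0, 1:]"
    by (simp_all add: pcompose_pCons)
  then have "pcompose (pcompose p [:c, 1:]) [:- c, 1:] = p"
    and "pcompose (pcompose q [:- c, 1:]) [:c, 1:] = q"
    by (simp_all flip: pcompose_assoc)
  then show ?thesis by auto
qed

section \<open>The order bound for exponential polynomials\<close>

definition exp_poly_fps :: "'a::field_char_0 \<Rightarrow> 'a poly \<Rightarrow> 'a poly \<Rightarrow> 'a fps" where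
  "exp_poly_fps t P S = fps_of_poly P + fps_exp t * fps_of_poly S"

lemma exp_poly_fps_diff:
  "exp_poly_fps t (P - P') (S - S') = exp_poly_fps t P S - exp_poly_fps t P' S'"
  by (simp add: exp_poly_fps_def fps_of_poly_diff algebra_simps)

lemma fps_deriv_exp_poly_fps:
  "fps_deriv (exp_poly_fps t P S) = exp_poly_fps t (pderiv P) (pderiv S + smult t S)"
  by (simp add: exp_poly_fps_def fps_of_poly_pderiv fps_of_poly_add fps_of_poly_smult algebra_simps)

text \<open>
  Differentiation lowers the degree of a polynomial, so it cannot cancel the leading term of \<open>t S\<close>.
\<close>

lemma pderiv_plus_smult_eq_0D:
  fixes S :: "'a::field_char_0 poly"
  assumes "pderiv S + smult t S = 0" "t \<noteq> 0"
  shows "S = 0"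
proof (rule ccontr)
  assume "S \<noteq> 0"
  have "coeff (pderiv S) (degree S) = 0"
    by (simp add: coeff_pderiv coeff_eq_0)
  then have "t * lead_coeff S = coeff (pderiv S + smult t S) (degree S)"
    by simp
  with assms \<open>S \<noteq> 0\<close> show False by simp
qed

text \<open>
  With \<open>n\<close> coefficients for \<open>P\<close> and \<open>m + 1\<close> for \<open>S\<close>, vanishing of the first \<open>n + m + 1\<close> Taylor
  coefficients forces both to be zero. Each derivative costs one order of vanishing and
  one coefficient of \<open>P\<close>, while \<open>S\<close> is replaced by \<open>S' + t S\<close>, which has the same degree and
  vanishes only if \<open>S\<close> does. Once \<open>P\<close> is gone, the unit \<open>e\<^sup>t\<^sup>u\<close> can be divided out.
\<close>

lemma exp_poly_fps_eq_0D:
  fixes P S :: "'a::field_char_0 poly"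
  assumes "t \<noteq> 0" "\<And>i. i \<ge> n \<Longrightarrow> coeff P i = 0" "degree S \<le> m"
    and "\<And>N. N \<le> m + n \<Longrightarrow> exp_poly_fps t P S $ N = 0"
  shows "P = 0 \<and> S = 0"
  using assms(2-)
proof (induction n arbitrary: P S)
  case 0
  have P: "P = 0"
    using 0(1) by (simp add: poly_eq_iff)
  have "fps_of_poly S = fps_exp (- t) * exp_poly_fps t P S"
    using fps_exp_add_mult[of "- t" t] by (simp add: exp_poly_fps_def P flip: mult.assoc)
  then have low: "coeff S N = (\<Sum>i=0..N. fps_exp (- t) $ i * exp_poly_fps t P S $ (N - i))" for N
    by (simp only: fps_mult_nth flip: fps_of_poly_nth)
  have "coeff S N = 0" for N
  proof (cases "N \<le> m")
    case True
    then show ?thesis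
      unfolding low using 0(3) by (intro sum.neutral) auto
  next
    case False
    then show ?thesis
      using 0(2) by (simp add: coeff_eq_0)
  qed
  then have "S = 0"
    by (simp add: poly_eq_iff)
  with P show ?case by simp
next
  case (Suc n)
  have "pderiv P = 0 \<and> pderiv S + smult t S = 0"
  proof (rule Suc.IH)
    show "coeff (pderiv P) i = 0" if "i \<ge> n" for i
      using Suc.prems(1)[of "Suc i"] that by (simp add: coeff_pderiv)
    show "degree (pderiv S + smult t S) \<le> m"
      using Suc.prems(2) by (intro degree_add_le) (auto simp: degree_pderiv)
    show "exp_poly_fps t (pderiv P) (pderiv S + smult t S) $ N = 0" if "N \<le> m + n" for N
      using Suc.prems(3)[of "Suc N"] that by (simp flip: fps_deriv_exp_poly_fps)
  qed
  then have P': "pderiv P = 0" and S: "S = 0"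
    using pderiv_plus_smult_eq_0D assms(1) by blast+
  from P' obtain c where c: "P = [:c:]"
    using pderiv_iszero by blast
  have "c = 0"
    using Suc.prems(3)[of 0] by (simp add: exp_poly_fps_def c S)
  with c S show ?case by simp
qed

section \<open>The explicit Pade pair\<close>

text \<open>
  The quotient \<open>- pade_P / pade_S\<close> is the Pade approximant of \<open>e\<^sup>t\<^sup>u\<close> with numerator degree \<open>n\<close> and
  denominator degree \<open>m\<close>, normalised so that the numerator is monic. For \<open>t = - \<tau>\<close> the signs of the
  theorem come from the powers of \<open>t\<close>.
\<close>

definition pade_P :: "nat \<Rightarrow> nat \<Rightarrow> 'a::field_char_0 \<Rightarrow> 'a poly" where
  "pade_P n m t =
     (\<Sum>j\<le>n. monom (fact n * of_nat ((m + n - j) choose m) / (fact j * t ^ (n - j))) j)"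

definition pade_S :: "nat \<Rightarrow> nat \<Rightarrow> 'a::field_char_0 \<Rightarrow> 'a poly" where
  "pade_S n m t =
     (\<Sum>j\<le>m. monom (- ((- 1) ^ j * fact (m + n - j) / (fact j * fact (m - j) * t ^ (n - j)))) j)"

text \<open>
  Both sides satisfy \<open>T (N + 1) m = T N m - T N (m - 1)\<close> for \<open>m > 0\<close> by Pascal's rule. In terms of generating
  functions, both sides are the coefficient of \<open>x\<^sup>m\<close> in \<open>(1 - x)\<^sup>N / (1 - x)\<^sup>n\<^sup>+\<^sup>1\<close>; for \<open>N > n\<close> this is a
  polynomial of degree \<open>N - n - 1 < m\<close>, and both sides are \<open>0\<close>.
\<close>

lemma alternating_binomial_sum:
  assumes "N \<le> m + n"
  shows "(\<Sum>j\<le>m. (- 1) ^ j * of_nat (N choose j) * of_nat ((m + n - j) choose n))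
       = (of_nat ((m + n - N) choose m) :: 'a::comm_ring_1)"
  using assms
proof (induction N arbitrary: m)
  case 0
  have "(\<Sum>j\<le>m. (- 1) ^ j * of_nat (0 choose j) * of_nat ((m + n - j) choose n))
      = (\<Sum>j\<in>{0}. of_nat ((m + n - j) choose n) :: 'a)"
    by (rule sum.mono_neutral_cong_right) (auto simp: binomial_eq_0)
  also have "\<dots> = of_nat ((m + n) choose m)"
    using binomial_symmetric[of m "m + n"] by simp
  finally show ?case by simp
next
  case (Suc N)
  show ?case
  proof (cases m)
    case 0
    then show ?thesis by simp
  next
    case m: (Suc m')
    have N: "N \<le> m + n" and N': "N \<le> m' + n"
      using Suc.prems m by simp_all
    let ?T = "\<lambda>N m j. (- 1) ^ j * of_nat (N choose j) * of_nat ((m + n - j) choose n) :: 'a"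
    have "(\<Sum>j\<le>m. ?T (Suc N) m j) = (\<Sum>j\<le>m. ?T N m j) - (\<Sum>j\<le>m'. ?T N m' j)"
      unfolding m sum.atMost_Suc_shift
      by (simp add: algebra_simps sum.distrib sum_negf sum_subtractf)
    also have "\<dots> = of_nat ((m + n - N) choose m) - of_nat ((m' + n - N) choose m')"
      by (simp only: Suc.IH[OF N] Suc.IH[OF N'])
    also have "m + n - N = Suc (m' + n - N)"
      using Suc.prems m by simp
    also have "of_nat (Suc (m' + n - N) choose m) - of_nat ((m' + n - N) choose m')
        = (of_nat ((m' + n - N) choose m) :: 'a)"
      by (simp add: m)
    also have "m' + n - N = m + n - Suc N"
      using m by simp
    finally show ?thesis .
  qed
qed

text \<open>
  Beyond \<open>N = n\<close>, where \<open>pade_P\<close> has no coefficients, the binomial coefficient \<open>m + n - N\<close> over \<open>m\<close>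
  is \<open>0\<close>, so that one formula serves for
  all \<open>N \<le> m + n\<close>.
\<close>

lemma exp_poly_fps_pade_nth:
  fixes t :: "'a::field_char_0"
  assumes "t \<noteq> 0" "m \<le> n" "N \<le> m + n"
  shows "exp_poly_fps t (pade_P n m t) (pade_S n m t) $ N = 0"
proof -
  let ?c = "fact n * t ^ N / (fact N * t ^ n) :: 'a"
  \<comment> \<open>After division by the factor \<open>?c\<close>, which is independent of \<open>j\<close>, the convolution becomes
    the alternating binomial sum.\<close>
  have S: "coeff (pade_S n m t) j * (t ^ (N - j) / fact (N - j))
      = - ?c * ((- 1) ^ j * of_nat (N choose j) * of_nat ((m + n - j) choose n))"
    if "j \<le> N" "j \<le> m" for j
  proof -
    have N: "t ^ N = t ^ (N - j) * t ^ j" and n: "t ^ n = t ^ (n - j) * t ^ j"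
      using that assms by (simp_all flip: power_add)
    have "n \<le> m + n - j" "m + n - j - n = m - j"
      using that by simp_all
    then show ?thesis
      using that \<open>t \<noteq> 0\<close>
      by (simp add: pade_S_def coeff_sum_monom_atMost binomial_fact N n field_simps)
  qed
  have "(fps_exp t * fps_of_poly (pade_S n m t)) $ N
      = (\<Sum>j\<le>N. coeff (pade_S n m t) j * (t ^ (N - j) / fact (N - j)))"
    by (simp add: mult.commute[of "fps_exp t"] fps_mult_nth atLeast0AtMost)
  also have "\<dots> = (\<Sum>j\<in>{..N} \<inter> {..m}. - ?c * ((- 1) ^ j * of_nat (N choose j) * of_nat ((m + n - j) choose n)))"
    by (rule sum.mono_neutral_cong_right)
       (use S in \<open>auto simp: pade_S_def coeff_sum_monom_atMost\<close>)
  also have "\<dots> = (\<Sum>j\<le>m. - ?c * ((- 1) ^ j * of_nat (N choose j) * of_nat ((m + n - j) choose n)))"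
    by (rule sum.mono_neutral_left) (auto simp: binomial_eq_0)
  also have "\<dots> = - ?c * of_nat ((m + n - N) choose m)"
    by (simp only: alternating_binomial_sum[OF assms(3)] flip: sum_distrib_left)
  finally have "(fps_exp t * fps_of_poly (pade_S n m t)) $ N = \<dots>" .
  moreover have "coeff (pade_P n m t) N = ?c * of_nat ((m + n - N) choose m)"
  proof (cases "N \<le> n")
    case True
    then have "t ^ n = t ^ (n - N) * t ^ N"
      by (simp flip: power_add)
    with True \<open>t \<noteq> 0\<close> show ?thesis
      by (simp add: pade_P_def coeff_sum_monom_atMost)
  next
    case False
    then show ?thesis
      using assms by (simp add: pade_P_def coeff_sum_monom_atMost binomial_eq_0)
  qed
  ultimately show ?thesis
    by (simp add: exp_poly_fps_def)
qed

lemma exp_poly_fps_nonzero: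
  fixes P S :: "'a::field_char_0 poly"
  assumes "t \<noteq> 0" "P \<noteq> 0"
  shows "exp_poly_fps t P S \<noteq> 0"
proof
  assume *: "exp_poly_fps t P S = 0"
  have "P = 0 \<and> S = 0"
    by (rule exp_poly_fps_eq_0D[OF assms(1), of "Suc (degree P)" _ _ "degree S"])
       (simp_all add: * coeff_eq_0)
  with assms(2) show False by simp
qed

text \<open>
  The order bound is used twice: for \<open>P\<close> itself with \<open>n + 1\<close> coefficients, so that the order is never
  larger than \<open>m + n + 1\<close>, and for the difference to the Pade pair, where the leading
  coefficients \<open>1\<close> cancel and only \<open>n\<close> coefficients remain.
\<close>

lemma subdegree_exp_poly_fps_eq_iff:
  fixes P S :: "'a::field_char_0 poly"
  assumes "t \<noteq> 0" "m \<le> n" "coeff P n = 1" "degree P \<le> n" "degree S \<le> m"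
  shows "subdegree (exp_poly_fps t P S) = m + n + 1 \<longleftrightarrow> P = pade_P n m t \<and> S = pade_S n m t"
proof -
  have "P \<noteq> 0"
    using assms(3) by auto
  then have nz: "exp_poly_fps t P S \<noteq> 0"
    by (rule exp_poly_fps_nonzero[OF assms(1)])
  have le: "subdegree (exp_poly_fps t P S) \<le> m + n + 1"
  proof (rule ccontr)
    assume *: "\<not> subdegree (exp_poly_fps t P S) \<le> m + n + 1"
    have "P = 0 \<and> S = 0"
    proof (rule exp_poly_fps_eq_0D[OF assms(1)])
      show "coeff P i = 0" if "i \<ge> Suc n" for i
        using that assms(4) by (simp add: coeff_eq_0)
      show "exp_poly_fps t P S $ N = 0" if "N \<le> m + Suc n" for N
        using * that by (intro nth_less_subdegree_zero) simp
    qed (rule assms(5))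
    with \<open>P \<noteq> 0\<close> show False by simp
  qed
  show ?thesis
  proof
    assume sub: "subdegree (exp_poly_fps t P S) = m + n + 1"
    have "P - pade_P n m t = 0 \<and> S - pade_S n m t = 0"
    proof (rule exp_poly_fps_eq_0D[OF assms(1)])
      show "coeff (P - pade_P n m t) i = 0" if "i \<ge> n" for i
        using that assms(3,4)
        by (cases "i = n") (auto simp: pade_P_def coeff_sum_monom_atMost coeff_eq_0)
      show "degree (S - pade_S n m t) \<le> m"
        using assms(5) by (intro degree_diff_le) (auto simp: pade_S_def degree_sum_monom_atMost)
      show "exp_poly_fps t (P - pade_P n m t) (S - pade_S n m t) $ N = 0" if "N \<le> m + n" for N
      proof -
        have "exp_poly_fps t P S $ N = 0"
          using that sub by (intro nth_less_subdegree_zero) simp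
        then show ?thesis
          using exp_poly_fps_pade_nth[OF assms(1,2) that] by (simp add: exp_poly_fps_diff)
      qed
    qed
    then show "P = pade_P n m t \<and> S = pade_S n m t" by simp
  next
    assume "P = pade_P n m t \<and> S = pade_S n m t"
    then have PS: "P = pade_P n m t" "S = pade_S n m t" by simp_all
    have "exp_poly_fps t P S $ N = 0" if "N < m + n + 1" for N
      unfolding PS using that by (intro exp_poly_fps_pade_nth assms(1,2)) simp
    with nz have "subdegree (exp_poly_fps t P S) \<ge> m + n + 1"
      by (rule subdegree_geI)
    with le show "subdegree (exp_poly_fps t P S) = m + n + 1" by simp
  qed
qed

section \<open>The expansion of the quasipolynomial at a point\<close>

lemma root_of_multiplicity_iff_subdegree:
  assumes "(\<lambda>w. f (z + w)) has_fps_expansion F" "F \<noteq> 0" "N > 0"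
  shows "root_of_multiplicity f z N \<longleftrightarrow> subdegree F = N"
proof -
  have "f z = F $ 0"
    using has_fps_expansion_imp_0_eq_fps_nth_0[OF assms(1)] by simp
  moreover have "zorder f z = int (subdegree F)"
    by (rule has_fps_expansion_zorder[OF assms(1,2)])
  ultimately show ?thesis
    using assms(3) by (auto simp: root_of_multiplicity_def)
qed

lemma has_fps_expansion_fps_of_poly:
  fixes p :: "complex poly"
  shows "poly p has_fps_expansion fps_of_poly p"
  by (simp add: has_fps_expansion_def)

lemma quasipoly_has_fps_expansion:
  fixes n m :: nat and \<tau> :: real and a \<alpha> :: "nat \<Rightarrow> real" and z :: complex
  defines "A \<equiv> \<Sum>k\<le>n. monom (if k = n then 1 else of_real (a k)) k"
    and "B \<equiv> \<Sum>k\<le>m. monom (of_real (\<alpha> k)) k"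
  shows "(\<lambda>w. quasipoly n m \<tau> a \<alpha> (z + w)) has_fps_expansion
    exp_poly_fps (- of_real \<tau>) (pcompose A [:z, 1:]) (smult (exp (- z * of_real \<tau>)) (pcompose B [:z, 1:]))"
proof -
  let ?P = "pcompose A [:z, 1:]"
    and ?S = "smult (exp (- z * of_real \<tau>)) (pcompose B [:z, 1:])"
  have "quasipoly n m \<tau> a \<alpha> (z + w) = poly ?P w + exp (- of_real \<tau> * w) * poly ?S w" for w
  proof -
    have A: "poly A (z + w) = (z + w) ^ n + (\<Sum>k<n. of_real (a k) * (z + w) ^ k)"
      by (simp add: A_def poly_sum poly_monom flip: lessThan_Suc_atMost)
    have "exp (- (z + w) * of_real \<tau>) = exp (- of_real \<tau> * w) * exp (- z * of_real \<tau>)"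
      by (simp add: algebra_simps flip: exp_add)
    then show ?thesis
      by (simp add: quasipoly_def A B_def poly_pcompose poly_sum poly_monom mult.assoc)
  qed
  then have "(\<lambda>w. quasipoly n m \<tau> a \<alpha> (z + w)) = (\<lambda>w. poly ?P w + exp (- of_real \<tau> * w) * poly ?S w)"
    by (rule ext)
  then show ?thesis
    unfolding exp_poly_fps_def
    by (simp only: has_fps_expansion_add has_fps_expansion_mult has_fps_expansion_exp
        has_fps_expansion_fps_of_poly)
qed

section \<open>The coefficients in the original variable\<close>

lemma coeff_shift_pade_P:
  fixes \<tau> s0 :: real
  assumes "k \<le> n"
  shows "coeff (pcompose (pade_P n m (- complex_of_real \<tau>)) [:- of_real s0, 1:]) k =
    (if k = n then 1 else of_real (real (n choose k) * (- s0) ^ (n - k)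
         + (- 1) ^ (n - k) * fact n *
           (\<Sum>j = k..n - 1. real (j choose k) * real ((m + n - j) choose m) * s0 ^ (j - k)
              / (fact j * \<tau> ^ (n - j)))))"
proof -
  let ?t = "- complex_of_real \<tau>" and ?s = "- complex_of_real s0"
  let ?f = "\<lambda>j. coeff (pade_P n m ?t) j * of_nat (j choose k) * ?s ^ (j - k)"
  have "coeff (pcompose (pade_P n m ?t) [:?s, 1:]) k = (\<Sum>j = k..n. ?f j)"
    by (rule coeff_pcompose_shift) (simp add: pade_P_def degree_sum_monom_atMost)
  also have "\<dots> = ?f n + (\<Sum>j = k..<n. ?f j)"
    using assms by (simp add: sum.last_plus)
  also have "?f n = of_real (real (n choose k) * (- s0) ^ (n - k))"
    by (simp add: pade_P_def coeff_sum_monom_atMost)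
  also have "(\<Sum>j = k..<n. ?f j) = (\<Sum>j = k..<n. of_real ((- 1) ^ (n - k) * fact n *
      (real (j choose k) * real ((m + n - j) choose m) * s0 ^ (j - k) / (fact j * \<tau> ^ (n - j)))))"
  proof (rule sum.cong)
    fix j assume j: "j \<in> {k..<n}"
    \<comment> \<open>The power of \<open>- \<tau>\<close> and the shift by \<open>- s0\<close> each contribute a sign that depends on \<open>j\<close>;
      their product does not, so it can be taken out of the sum.\<close>
    have "(- 1) ^ (n - k) = (- 1) ^ (n - j) * (- 1 :: complex) ^ (j - k)"
      using j by (simp flip: power_add)
    with j show "?f j = of_real ((- 1) ^ (n - k) * fact n *
      (real (j choose k) * real ((m + n - j) choose m) * s0 ^ (j - k) / (fact j * \<tau> ^ (n - j))))"
      by (simp add: pade_P_def coeff_sum_monom_atMost power_minus[of "complex_of_real \<tau>"]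
          power_minus[of "complex_of_real s0"] divide_simps)
  qed auto
  also have "\<dots> = of_real ((- 1) ^ (n - k) * fact n *
      (\<Sum>j = k..<n. real (j choose k) * real ((m + n - j) choose m) * s0 ^ (j - k)
              / (fact j * \<tau> ^ (n - j))))"
    by (simp only: sum_distrib_left of_real_sum)
  finally have eq: "coeff (pcompose (pade_P n m ?t) [:?s, 1:]) k =
    of_real (real (n choose k) * (- s0) ^ (n - k)) + \<dots>" .
  show ?thesis
  proof (cases "k = n")
    case True
    then show ?thesis
      unfolding eq by simp
  next
    case False
    then have "{k..<n} = {k..n - 1}"
      using assms by auto
    with False show ?thesis
      unfolding eq by (simp only: if_False of_real_add)
  qed
qed

lemma coeff_shift_pade_S:
  fixes \<tau> s0 :: real
  assumes "k \<le> m" "m \<le> n" "n \<ge> 1"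
  shows "coeff (pcompose (pade_S n m (- complex_of_real \<tau>)) [:- of_real s0, 1:]) k =
    of_real ((- 1) ^ (n - 1) * (\<Sum>j = k..m. (- 1) ^ (j - k) * fact (m + n - j) * s0 ^ (j - k)
            / (fact k * fact (j - k) * fact (m - j) * \<tau> ^ (n - j))))"
proof -
  let ?t = "- complex_of_real \<tau>" and ?s = "- complex_of_real s0"
  let ?f = "\<lambda>j. coeff (pade_S n m ?t) j * of_nat (j choose k) * ?s ^ (j - k)"
  have "coeff (pcompose (pade_S n m ?t) [:?s, 1:]) k = (\<Sum>j = k..m. ?f j)"
    by (rule coeff_pcompose_shift) (simp add: pade_S_def degree_sum_monom_atMost)
  also have "\<dots> = (\<Sum>j = k..m. of_real ((- 1) ^ (n - 1) * ((- 1) ^ (j - k) * fact (m + n - j)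
      * s0 ^ (j - k) / (fact k * fact (j - k) * fact (m - j) * \<tau> ^ (n - j)))))"
  proof (rule sum.cong)
    fix j assume j: "j \<in> {k..m}"
    \<comment> \<open>The sign \<open>- (- 1)\<^sup>j\<close> of the Pade coefficient absorbs the sign in the power of \<open>- \<tau>\<close>.\<close>
    have "- ((- 1) ^ j) = (- 1) ^ (n - 1) * (- 1 :: complex) ^ (n - j)"
      using j assms by (auto simp: minus_one_power_iff)
    then have sign: "- ((- 1) ^ j) / ?t ^ (n - j) = (- 1) ^ (n - 1) / of_real \<tau> ^ (n - j)"
      by (simp add: power_minus[of "complex_of_real \<tau>"])
    have "?f j = - ((- 1) ^ j) / ?t ^ (n - j) *
        (fact (m + n - j) / (fact j * fact (m - j)) * of_nat (j choose k) * ?s ^ (j - k))"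
      using j by (simp add: pade_S_def coeff_sum_monom_atMost ac_simps)
    also have "\<dots> = of_real ((- 1) ^ (n - 1) * ((- 1) ^ (j - k) * fact (m + n - j)
      * s0 ^ (j - k) / (fact k * fact (j - k) * fact (m - j) * \<tau> ^ (n - j))))"
      unfolding sign using j
      by (simp add: binomial_fact power_minus[of "complex_of_real s0"] ac_simps)
    finally show "?f j = of_real ((- 1) ^ (n - 1) * ((- 1) ^ (j - k) * fact (m + n - j)
      * s0 ^ (j - k) / (fact k * fact (j - k) * fact (m - j) * \<tau> ^ (n - j))))" .
  qed auto
  finally show ?thesis
    by (simp only: sum_distrib_left of_real_sum)
qed

theorem theorem3p1:
  fixes n m :: nat and \<tau> s0 :: real and a \<alpha> :: "nat \<Rightarrow> real"
  assumes "n \<ge> 1" and "m \<le> n" and "\<tau> > 0"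
  shows "root_of_multiplicity (quasipoly n m \<tau> a \<alpha>) (complex_of_real s0) (m + n + 1) \<longleftrightarrow>
    (\<forall>k. k \<le> n - 1 \<longrightarrow>
       a k = real (n choose k) * (- s0) ^ (n - k)
         + (- 1) ^ (n - k) * fact n *
           (\<Sum>j = k..n - 1. real (j choose k) * real ((m + n - j) choose m) * s0 ^ (j - k)
              / (fact j * \<tau> ^ (n - j))))
    \<and> (\<forall>k. k \<le> m \<longrightarrow>
       \<alpha> k = (- 1) ^ (n - 1) * exp (s0 * \<tau>) *
         (\<Sum>j = k..m. (- 1) ^ (j - k) * fact (m + n - j) * s0 ^ (j - k)
            / (fact k * fact (j - k) * fact (m - j) * \<tau> ^ (n - j))))"
proof -
  define z t where "z = complex_of_real s0" and "t = - complex_of_real \<tau>"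
  define a' where "a' k = real (n choose k) * (- s0) ^ (n - k)
         + (- 1) ^ (n - k) * fact n *
           (\<Sum>j = k..n - 1. real (j choose k) * real ((m + n - j) choose m) * s0 ^ (j - k)
              / (fact j * \<tau> ^ (n - j)))" for k
  define \<sigma> where "\<sigma> k = (\<Sum>j = k..m. (- 1) ^ (j - k) * fact (m + n - j) * s0 ^ (j - k)
            / (fact k * fact (j - k) * fact (m - j) * \<tau> ^ (n - j)))" for k
  define A :: "complex poly" where "A = (\<Sum>k\<le>n. monom (if k = n then 1 else of_real (a k)) k)"
  define B :: "complex poly" where "B = (\<Sum>k\<le>m. monom (of_real (\<alpha> k)) k)"
  define E where "E = exp (- z * of_real \<tau>)"
  define P S where "P = pcompose A [:z, 1:]" and "S = smult E (pcompose B [:z, 1:])"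
  have "t \<noteq> 0"
    using assms(3) by (simp add: t_def)
  have E: "E = of_real (inverse (exp (s0 * \<tau>)))"
    by (simp add: E_def z_def exp_minus flip: exp_of_real)
  have degA: "degree A \<le> n" and degB: "degree B \<le> m"
    by (simp_all add: A_def B_def degree_sum_monom_atMost)
  have degP: "degree P \<le> n" and degS: "degree S \<le> m"
    unfolding P_def S_def
    by (intro degree_pcompose_shift_le degA degB order.trans[OF degree_smult_le])+
  have deg_pade: "degree (pcompose (pade_P n m t) [:- z, 1:]) \<le> n"
    "degree (pcompose (pade_S n m t) [:- z, 1:]) \<le> m"
    by (intro degree_pcompose_shift_le; simp add: pade_P_def pade_S_def degree_sum_monom_atMost)+
  have coeff_P: "coeff (pcompose (pade_P n m t) [:- z, 1:]) k = (if k = n then 1 else of_real (a' k))"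
    if "k \<le> n" for k
    unfolding t_def z_def a'_def by (rule coeff_shift_pade_P[OF that])
  have coeff_S: "coeff (pcompose (pade_S n m t) [:- z, 1:]) k = of_real ((- 1) ^ (n - 1) * \<sigma> k)"
    if "k \<le> m" for k
    unfolding t_def z_def \<sigma>_def by (rule coeff_shift_pade_S[OF that assms(2,1)])
  have "coeff P n = 1"
    unfolding P_def coeff_pcompose_shift[OF degA] by (simp add: A_def coeff_sum_monom_atMost)
  then have "P \<noteq> 0" by auto
  have exp: "(\<lambda>w. quasipoly n m \<tau> a \<alpha> (z + w)) has_fps_expansion exp_poly_fps t P S"
    unfolding t_def P_def S_def A_def B_def E_def by (rule quasipoly_has_fps_expansion)
  have "root_of_multiplicity (quasipoly n m \<tau> a \<alpha>) z (m + n + 1)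
      \<longleftrightarrow> subdegree (exp_poly_fps t P S) = m + n + 1"
    by (rule root_of_multiplicity_iff_subdegree[OF exp])
       (use exp_poly_fps_nonzero[OF \<open>t \<noteq> 0\<close> \<open>P \<noteq> 0\<close>] in simp_all)
  also have "\<dots> \<longleftrightarrow> P = pade_P n m t \<and> S = pade_S n m t"
    by (rule subdegree_exp_poly_fps_eq_iff) fact+
  also have "P = pade_P n m t \<longleftrightarrow> (\<forall>k\<le>n - 1. a k = a' k)"
  proof -
    have "P = pade_P n m t \<longleftrightarrow> A = pcompose (pade_P n m t) [:- z, 1:]"
      unfolding P_def by (rule pcompose_shift_eq_iff)
    also have "\<dots> \<longleftrightarrow> (\<forall>k\<le>n. coeff A k = coeff (pcompose (pade_P n m t) [:- z, 1:]) k)"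
      by (rule poly_eq_iff_coeff_le[OF degA deg_pade(1)])
    also have "\<dots> \<longleftrightarrow> (\<forall>k\<le>n. k = n \<or> a k = a' k)"
      by (simp add: A_def coeff_sum_monom_atMost coeff_P) blast
    also have "\<dots> \<longleftrightarrow> (\<forall>k\<le>n - 1. a k = a' k)"
    proof -
      have "k \<le> n - 1 \<longleftrightarrow> k \<le> n \<and> k \<noteq> n" for k
        using assms(1) by auto
      then show ?thesis by auto
    qed
    finally show ?thesis .
  qed
  also have "S = pade_S n m t \<longleftrightarrow> (\<forall>k\<le>m. \<alpha> k = (- 1) ^ (n - 1) * exp (s0 * \<tau>) * \<sigma> k)"
  proof -
    have "S = pade_S n m t \<longleftrightarrow> smult E B = pcompose (pade_S n m t) [:- z, 1:]"
      by (simp add: S_def pcompose_shift_eq_iff flip: pcompose_smult)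
    also have "\<dots> \<longleftrightarrow> (\<forall>k\<le>m. coeff (smult E B) k = coeff (pcompose (pade_S n m t) [:- z, 1:]) k)"
      by (rule poly_eq_iff_coeff_le[OF order.trans[OF degree_smult_le degB] deg_pade(2)])
    also have "\<dots> \<longleftrightarrow> (\<forall>k\<le>m. complex_of_real (inverse (exp (s0 * \<tau>)) * \<alpha> k)
        = of_real ((- 1) ^ (n - 1) * \<sigma> k))"
      by (simp only: B_def coeff_smult coeff_sum_monom_atMost coeff_S E
          of_real_mult if_True cong: imp_cong)
    also have "\<dots> \<longleftrightarrow> (\<forall>k\<le>m. \<alpha> k = (- 1) ^ (n - 1) * exp (s0 * \<tau>) * \<sigma> k)"
      by (simp only: of_real_eq_iff) (simp add: field_simps)
    finally show ?thesis .
  qed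
  finally show ?thesis
    unfolding z_def a'_def \<sigma>_def .
qed

end
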